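(* Let $F:\mathcal{C}\to\mathcal{D}$ be a functor and let $F^\natural:\mathcal{C}^\natural\to\mathcal{D}^\natural$ be its idempotent completion. Then: (1) $F$ is faithful if and only if so is $F^\natural$; (2) $F$ is full if and only if so is $F^\natural$; (3) $F$ is fully faithful if and only if so is $F^\natural$.
   Context: The idempotent completion (Karoubi envelope) $\mathcal{C}^\natural$ of a category $\mathcal{C}$ has as objects the pairs $(X,e)$ with $X$ an object of $\mathcal{C}$ and $e:X\to X$ an idempotent morphism ($e\circ e=e$); a morphism $f:(X,e)\to(X',e')$ in $\mathcal{C}^\natural$ is a morphism $f:X\to X'$ in $\mathcal{C}$ with $f=e'\circ f\circ e$; composition is that of $\mathcal{C}$ and $\mathrm{Id}_{(X,e)}=e$. A functor $F:\mathcal{C}\to\mathcal{D}$ induces its completion $F^\natural:\mathcal{C}^\natural\to\mathcal{D}^\natural$, $F^\natural(X,e)=(FX,Fe)$, $F^\natural(f)=F(f)$. *)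

theory Defs
  imports Main
begin

text \<open>
  Hom-sets are not required to be pairwise disjoint, so composition (and, below, the action of a
  functor on morphisms) takes the source and target objects as arguments. In the idempotent
  completion a single morphism of the base category indeed lies in several hom-sets.
  \<open>Comp C X Y Z g f\<close> is \<open>g \<circ> f\<close> for \<open>f : X \<rightarrow> Y\<close> and \<open>g : Y \<rightarrow> Z\<close>.
\<close>

record ('o, 'm) cat =
  Obj :: "'o set"
  Hom :: "'o \<Rightarrow> 'o \<Rightarrow> 'm set"
  Comp :: "'o \<Rightarrow> 'o \<Rightarrow> 'o \<Rightarrow> 'm \<Rightarrow> 'm \<Rightarrow> 'm"
  Ident :: "'o \<Rightarrow> 'm"

locale category =
  fixes C :: "('o, 'm) cat"
  assumes comp_closed:
      "\<lbrakk>X \<in> Obj C; Y \<in> Obj C; Z \<in> Obj C; f \<in> Hom C X Y; g \<in> Hom C Y Z\<rbrakk>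
        \<Longrightarrow> Comp C X Y Z g f \<in> Hom C X Z"
    and comp_assoc:
      "\<lbrakk>W \<in> Obj C; X \<in> Obj C; Y \<in> Obj C; Z \<in> Obj C;
        f \<in> Hom C W X; g \<in> Hom C X Y; h \<in> Hom C Y Z\<rbrakk>
        \<Longrightarrow> Comp C W X Z (Comp C X Y Z h g) f = Comp C W Y Z h (Comp C W X Y g f)"
    and ident_closed: "X \<in> Obj C \<Longrightarrow> Ident C X \<in> Hom C X X"
    and ident_left:
      "\<lbrakk>X \<in> Obj C; Y \<in> Obj C; f \<in> Hom C X Y\<rbrakk> \<Longrightarrow> Comp C X Y Y (Ident C Y) f = f"
    and ident_right:
      "\<lbrakk>X \<in> Obj C; Y \<in> Obj C; f \<in> Hom C X Y\<rbrakk> \<Longrightarrow> Comp C X X Y f (Ident C X) = f"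

record ('o, 'm, 'p, 'n) cfunctor =
  fobj :: "'o \<Rightarrow> 'p"
  fmor :: "'o \<Rightarrow> 'o \<Rightarrow> 'm \<Rightarrow> 'n"

locale is_functor = dom: category C + cod: category D
  for C :: "('o, 'm) cat" and D :: "('p, 'n) cat" +
  fixes F :: "('o, 'm, 'p, 'n) cfunctor"
  assumes fobj_closed: "X \<in> Obj C \<Longrightarrow> fobj F X \<in> Obj D"
    and fmor_closed:
      "\<lbrakk>X \<in> Obj C; Y \<in> Obj C; f \<in> Hom C X Y\<rbrakk>
        \<Longrightarrow> fmor F X Y f \<in> Hom D (fobj F X) (fobj F Y)"
    and fmor_ident: "X \<in> Obj C \<Longrightarrow> fmor F X X (Ident C X) = Ident D (fobj F X)"
    and fmor_comp:
      "\<lbrakk>X \<in> Obj C; Y \<in> Obj C; Z \<in> Obj C; f \<in> Hom C X Y; g \<in> Hom C Y Z\<rbrakk>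
        \<Longrightarrow> fmor F X Z (Comp C X Y Z g f) =
            Comp D (fobj F X) (fobj F Y) (fobj F Z) (fmor F Y Z g) (fmor F X Y f)"

definition faithful ::
    "('o, 'm) cat \<Rightarrow> ('p, 'n) cat \<Rightarrow> ('o, 'm, 'p, 'n) cfunctor \<Rightarrow> bool" where
  "faithful C D F \<longleftrightarrow> (\<forall>X \<in> Obj C. \<forall>Y \<in> Obj C. inj_on (fmor F X Y) (Hom C X Y))"

definition full ::
    "('o, 'm) cat \<Rightarrow> ('p, 'n) cat \<Rightarrow> ('o, 'm, 'p, 'n) cfunctor \<Rightarrow> bool" where
  "full C D F \<longleftrightarrow>
    (\<forall>X \<in> Obj C. \<forall>Y \<in> Obj C. fmor F X Y ` Hom C X Y = Hom D (fobj F X) (fobj F Y))"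

definition fully_faithful ::
    "('o, 'm) cat \<Rightarrow> ('p, 'n) cat \<Rightarrow> ('o, 'm, 'p, 'n) cfunctor \<Rightarrow> bool" where
  "fully_faithful C D F \<longleftrightarrow>
    (\<forall>X \<in> Obj C. \<forall>Y \<in> Obj C.
      bij_betw (fmor F X Y) (Hom C X Y) (Hom D (fobj F X) (fobj F Y)))"

definition idem_completion :: "('o, 'm) cat \<Rightarrow> ('o \<times> 'm, 'm) cat" where
  "idem_completion C =
    \<lparr> Obj = {(X, e). X \<in> Obj C \<and> e \<in> Hom C X X \<and> Comp C X X X e e = e},
      Hom = (\<lambda>(X, e) (X', e').
        {f \<in> Hom C X X'. f = Comp C X X X' (Comp C X X' X' e' f) e}),
      Comp = (\<lambda>(X, _) (Y, _) (Z, _). Comp C X Y Z),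
      Ident = (\<lambda>(X, e). e) \<rparr>"

definition functor_completion ::
    "('o, 'm, 'p, 'n) cfunctor \<Rightarrow> ('o \<times> 'm, 'm, 'p \<times> 'n, 'n) cfunctor" where
  "functor_completion F =
    \<lparr> fobj = (\<lambda>(X, e). (fobj F X, fmor F X X e)),
      fmor = (\<lambda>(X, _) (Y, _). fmor F X Y) \<rparr>"

lemma (in category) idem_hom_iff:
  assumes "X \<in> Obj C" "e \<in> Hom C X X" "Comp C X X X e e = e"
    and "Y \<in> Obj C" "d \<in> Hom C Y Y" "Comp C Y Y Y d d = d"
    and "f \<in> Hom C X Y"
  shows "f = Comp C X X Y (Comp C X Y Y d f) e \<longleftrightarrow>
         Comp C X Y Y d f = f \<and> Comp C X X Y f e = f"
  using assms by (metis comp_assoc comp_closed)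

lemma (in category) category_idem_completion: "category (idem_completion C)"
proof (unfold_locales, goal_cases)
  case (1 X Y Z f g)
  then show ?case
    unfolding idem_completion_def
    by (clarsimp simp: idem_hom_iff comp_closed) (metis comp_assoc)
next
  case (2 W X Y Z f g h)
  then show ?case
    unfolding idem_completion_def by (auto intro: comp_assoc)
next
  case (3 X)
  then show ?case
    unfolding idem_completion_def by auto
next
  case (4 X Y f)
  then show ?case
    unfolding idem_completion_def by (clarsimp simp: idem_hom_iff)
next
  case (5 X Y f)
  then show ?case
    unfolding idem_completion_def by (clarsimp simp: idem_hom_iff)
qed

lemma (in is_functor) is_functor_functor_completion:
  "is_functor (idem_completion C) (idem_completion D) (functor_completion F)"
proof -
  interpret c: category "idem_completion C" by (rule dom.category_idem_completion)
  interpret d: category "idem_completion D" by (rule cod.category_idem_completion)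
  show ?thesis
  proof (unfold_locales, goal_cases)
    case (1 X)
    then show ?case
      unfolding idem_completion_def functor_completion_def
      by (auto simp: fobj_closed fmor_closed simp flip: fmor_comp)
  next
    case (2 X Y f)
    then show ?case
      unfolding idem_completion_def functor_completion_def
      by (clarsimp simp: fobj_closed fmor_closed dom.comp_closed simp flip: fmor_comp)
  next
    case (3 X)
    then show ?case
      unfolding idem_completion_def functor_completion_def by auto
  next
    case (4 X Y Z f g)
    then show ?case
      unfolding idem_completion_def functor_completion_def by (auto intro: fmor_comp)
  qed
qed

end

theory Submission
  imports Defs
begin

text \<open>
  The embedding \<open>X \<mapsto> (X, Ident C X)\<close> identifies \<open>F\<close> with a restriction of its completion, so
  each property descends to \<open>F\<close>. Conversely, hom-sets of the completion are subsets of the original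
  ones, which gives faithfulness, and a preimage \<open>f\<close> under \<open>F\<close> of a morphism
  \<open>(F X, F e) \<rightarrow> (F X', F e')\<close> can be replaced by the preimage \<open>e' \<circ> f \<circ> e\<close>, which gives fullness.
\<close>

lemma mem_Obj_idem_completion:
  "(X, e) \<in> Obj (idem_completion C) \<longleftrightarrow>
    X \<in> Obj C \<and> e \<in> Hom C X X \<and> Comp C X X X e e = e"
  by (simp add: idem_completion_def)

lemma mem_Hom_idem_completion:
  "f \<in> Hom (idem_completion C) (X, e) (Y, d) \<longleftrightarrow>
    f \<in> Hom C X Y \<and> f = Comp C X X Y (Comp C X Y Y d f) e"
  by (simp add: idem_completion_def)

lemma fobj_functor_completion:
  "fobj (functor_completion F) (X, e) = (fobj F X, fmor F X X e)"
  by (simp add: functor_completion_def)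

lemma fmor_functor_completion:
  "fmor (functor_completion F) (X, e) (Y, d) = fmor F X Y"
  by (simp add: functor_completion_def)

text \<open>Reduces the third equivalence to the first two: on each hom-set, \<open>bij_betw\<close>
  splits into injectivity and equality of the image with the target.\<close>

lemma fully_faithful_iff: "fully_faithful C D F \<longleftrightarrow> full C D F \<and> faithful C D F"
  by (auto simp: fully_faithful_def full_def faithful_def bij_betw_def)

context category
begin

lemma Ident_mem_Obj_idem_completion:
  "X \<in> Obj C \<Longrightarrow> (X, Ident C X) \<in> Obj (idem_completion C)"
  by (simp add: mem_Obj_idem_completion ident_closed ident_left)

text \<open>The identity laws make the compatibility condition automatic. The hom-sets agree
  literally, since the completion reuses the morphisms of \<open>C\<close>, so nothing has to be
  transported along the embedding.\<close>

lemma Hom_idem_completion_Ident: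
  assumes "X \<in> Obj C" "Y \<in> Obj C"
  shows "Hom (idem_completion C) (X, Ident C X) (Y, Ident C Y) = Hom C X Y"
  using assms by (auto simp: mem_Hom_idem_completion ident_left ident_right)

text \<open>Composing once more with \<open>d\<close> or \<open>e\<close> changes nothing, by
  associativity and idempotency. This allows an arbitrary morphism to be corrected to one of the
  completion.\<close>

lemma idem_conj_mem_Hom_idem_completion:
  assumes e: "(X, e) \<in> Obj (idem_completion C)" and d: "(Y, d) \<in> Obj (idem_completion C)"
    and f: "f \<in> Hom C X Y"
  shows "Comp C X X Y (Comp C X Y Y d f) e \<in> Hom (idem_completion C) (X, e) (Y, d)"
proof -
  have X: "X \<in> Obj C" "e \<in> Hom C X X" "Comp C X X X e e = e"
    and Y: "Y \<in> Obj C" "d \<in> Hom C Y Y" "Comp C Y Y Y d d = d"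
    using e d by (simp_all add: mem_Obj_idem_completion)
  \<comment> \<open>The composite is built in two stages: \<open>g\<close> absorbs \<open>d\<close>
    on the left, and \<open>h\<close> inherits this while also absorbing \<open>e\<close> on the
    right.\<close>
  define g where "g = Comp C X Y Y d f"
  have g: "g \<in> Hom C X Y"
    using X Y f by (simp add: g_def comp_closed)
  have dg: "Comp C X Y Y d g = g"
    using X Y f by (simp add: g_def flip: comp_assoc)
  define h where "h = Comp C X X Y g e"
  have h: "h \<in> Hom C X Y"
    using X Y g by (simp add: h_def comp_closed)
  have "Comp C X Y Y d h = h"
    using X Y g dg by (simp add: h_def flip: comp_assoc)
  moreover have "Comp C X X Y h e = h"
    using X Y g by (simp add: h_def comp_assoc)
  ultimately have "h \<in> Hom (idem_completion C) (X, e) (Y, d)"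
    using h by (simp add: mem_Hom_idem_completion)
  then show ?thesis
    by (simp add: g_def h_def)
qed

end

context is_functor
begin

text \<open>As \<open>F\<close> preserves identities, its completion sends embedded objects to
  embedded objects, so the hom-sets on the side of \<open>D\<close> collapse as well.\<close>

lemma fobj_functor_completion_Ident:
  "X \<in> Obj C \<Longrightarrow>
    fobj (functor_completion F) (X, Ident C X) = (fobj F X, Ident D (fobj F X))"
  by (simp add: fobj_functor_completion fmor_ident)

lemma faithful_functor_completion_iff:
  "faithful (idem_completion C) (idem_completion D) (functor_completion F) \<longleftrightarrow> faithful C D F"
  (is "?comp \<longleftrightarrow> ?base")
proof
  assume ?comp
  show ?base
    unfolding faithful_def
  proof (intro ballI)
    fix X Y
    assume XY: "X \<in> Obj C" "Y \<in> Obj C"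
    then have "inj_on (fmor (functor_completion F) (X, Ident C X) (Y, Ident C Y))
        (Hom (idem_completion C) (X, Ident C X) (Y, Ident C Y))"
      using \<open>?comp\<close> dom.Ident_mem_Obj_idem_completion unfolding faithful_def by blast
    then show "inj_on (fmor F X Y) (Hom C X Y)"
      by (simp add: fmor_functor_completion dom.Hom_idem_completion_Ident XY)
  qed
next
  assume ?base
  \<comment> \<open>The completion acts on morphisms by the same map \<open>fmor F X Y\<close>, so
    injectivity passes to the smaller hom-set.\<close>
  have "Hom (idem_completion C) (X, e) (Y, d) \<subseteq> Hom C X Y" for X e Y d
    by (auto simp: mem_Hom_idem_completion)
  with \<open>?base\<close> show ?comp
    unfolding faithful_def
    by (metis fmor_functor_completion inj_on_subset mem_Obj_idem_completion surj_pair)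
qed

lemma full_functor_completion_iff:
  "full (idem_completion C) (idem_completion D) (functor_completion F) \<longleftrightarrow> full C D F"
  (is "?comp \<longleftrightarrow> ?base")
proof
  assume ?comp
  show ?base
    unfolding full_def
  proof (intro ballI)
    fix X Y
    assume XY: "X \<in> Obj C" "Y \<in> Obj C"
    then have "fmor (functor_completion F) (X, Ident C X) (Y, Ident C Y) `
          Hom (idem_completion C) (X, Ident C X) (Y, Ident C Y) =
        Hom (idem_completion D) (fobj (functor_completion F) (X, Ident C X))
          (fobj (functor_completion F) (Y, Ident C Y))"
      using \<open>?comp\<close> dom.Ident_mem_Obj_idem_completion unfolding full_def by blast
    then show "fmor F X Y ` Hom C X Y = Hom D (fobj F X) (fobj F Y)"
      by (simp add: fmor_functor_completion dom.Hom_idem_completion_Ident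
          cod.Hom_idem_completion_Ident fobj_functor_completion_Ident fobj_closed XY)
  qed
next
  assume ?base
  \<comment> \<open>Since \<open>full\<close> is stated as an equality of sets, the image must also
    be shown to lie in the target; this is functoriality of the completion.\<close>
  interpret compl: is_functor "idem_completion C" "idem_completion D" "functor_completion F"
    by (rule is_functor_functor_completion)
  show ?comp
    unfolding full_def
  proof (intro ballI subset_antisym image_subsetI subsetI)
    fix A B f
    assume "A \<in> Obj (idem_completion C)" "B \<in> Obj (idem_completion C)"
      and "f \<in> Hom (idem_completion C) A B"
    then show "fmor (functor_completion F) A B f
        \<in> Hom (idem_completion D) (fobj (functor_completion F) A) (fobj (functor_completion F) B)"
      by (rule compl.fmor_closed)
  next
    fix A B g
    assume A: "A \<in> Obj (idem_completion C)" and B: "B \<in> Obj (idem_completion C)"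
      and g: "g \<in> Hom (idem_completion D)
        (fobj (functor_completion F) A) (fobj (functor_completion F) B)"
    obtain X e Y d where AB: "A = (X, e)" "B = (Y, d)"
      by fastforce
    have XY: "X \<in> Obj C" "e \<in> Hom C X X" "Y \<in> Obj C" "d \<in> Hom C Y Y"
      using A B by (simp_all add: AB mem_Obj_idem_completion)
    have g': "g \<in> Hom D (fobj F X) (fobj F Y)"
      and g_conj: "g = Comp D (fobj F X) (fobj F X) (fobj F Y)
        (Comp D (fobj F X) (fobj F Y) (fobj F Y) (fmor F Y Y d) g) (fmor F X X e)"
      using g by (simp_all add: AB fobj_functor_completion mem_Hom_idem_completion)
    \<comment> \<open>Fullness of \<open>F\<close> is applied to the underlying morphism only, so
      the preimage \<open>f\<close> need not be compatible with \<open>e\<close> and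
      \<open>d\<close>.\<close>
    have "g \<in> fmor F X Y ` Hom C X Y"
      using \<open>?base\<close> XY g' by (simp add: full_def)
    then obtain f where f: "f \<in> Hom C X Y" "fmor F X Y f = g"
      by blast
    let ?h = "Comp C X X Y (Comp C X Y Y d f) e"
    have "?h \<in> Hom (idem_completion C) A B"
      using A B f unfolding AB by (intro dom.idem_conj_mem_Hom_idem_completion)
    \<comment> \<open>Functoriality turns the image of \<open>?h\<close> into \<open>g\<close>
      composed with the images of \<open>d\<close> and \<open>e\<close>, which is \<open>g\<close>
      again by \<open>g_conj\<close>.\<close>
    moreover have "fmor F X Y ?h = g"
      using XY f g_conj by (simp add: fmor_comp dom.comp_closed)
    ultimately show "g \<in> fmor (functor_completion F) A B ` Hom (idem_completion C) A B"
      unfolding AB fmor_functor_completion by blast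
  qed
qed

end

theorem proposition2p1:
  fixes C :: "('o, 'm) cat" and D :: "('p, 'n) cat"
    and F :: "('o, 'm, 'p, 'n) cfunctor"
  assumes "is_functor C D F"
  shows "(faithful C D F \<longleftrightarrow>
            faithful (idem_completion C) (idem_completion D) (functor_completion F)) \<and>
         (full C D F \<longleftrightarrow>
            full (idem_completion C) (idem_completion D) (functor_completion F)) \<and>
         (fully_faithful C D F \<longleftrightarrow>
            fully_faithful (idem_completion C) (idem_completion D) (functor_completion F))"
proof -
  interpret is_functor C D F
    by (rule assms)
  show ?thesis
    by (simp add: fully_faithful_iff faithful_functor_completion_iff full_functor_completion_iff)
qed

end
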